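(* Let $X=\mathrm{Sp}_{2n}(2)$ with $n\ge2$, and let $\Gamma$ be an $X$-strongly incidence-transitive code in $J(\mathcal{Q}^\epsilon,k)$, where $2\le k\le|\mathcal{Q}^\epsilon|-2$, such that for $\Delta\in\Gamma$ the stabiliser $X_\Delta$ is irreducible on $V$. Then $X_\Delta$ is not contained in a maximal $\mathcal C_8$-subgroup of $X$, i.e. $X_\Delta\not\le X_\psi$ for every $\psi\in\mathcal{Q}$.
   Context: $V=\mathbb{F}_2^{2n}$ with symplectic form $B$, $X=\mathrm{Sp}_{2n}(2)$ its isometry group. $\mathcal{Q}$ is the set of quadratic forms $\phi:V\to\mathbb{F}_2$ with $\phi(x+y)+\phi(x)+\phi(y)=B(x,y)$ and $\mathcal{Q}^\epsilon$ those of type $\epsilon\in\{+,-\}$, $|\mathcal{Q}^\epsilon|=2^{n-1}(2^n+\epsilon)$; $X$ acts by $\phi^g(x)=\phi(xg^{-1})$. The maximal $\mathcal C_8$-subgroups of $X$ are the stabilisers $X_\psi\cong\mathrm{O}^{\pm}_{2n}(2)$ of forms $\psi\in\mathcal{Q}$. A code in $J(\mathcal{Q}^\epsilon,k)$ is a nonempty set of $k$-subsets of $\mathcal{Q}^\epsilon$; $X$-strongly incidence-transitive means $X$ preserves $\Gamma$, is transitive on it, and each $X_\Delta$ is transitive on $\Delta\times(\mathcal{Q}^\epsilon\setminus\Delta)$. Irreducible: no nonzero proper invariant subspace. *)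

theory Defs
  imports "HOL-Analysis.Cartesian_Space" "HOL-Library.Z2"
begin

definition bilinear_form :: "(bit ^ 'm \<Rightarrow> bit ^ 'm \<Rightarrow> bit) \<Rightarrow> bool" where
  "bilinear_form B \<longleftrightarrow>
     (\<forall>x. Vector_Spaces.linear (*s) (*) (\<lambda>y. B x y)) \<and>
     (\<forall>y. Vector_Spaces.linear (*s) (*) (\<lambda>x. B x y))"

definition symplectic_form :: "(bit ^ 'm \<Rightarrow> bit ^ 'm \<Rightarrow> bit) \<Rightarrow> bool" where
  "symplectic_form B \<longleftrightarrow>
     bilinear_form B \<and> (\<forall>x. B x x = 0) \<and> (\<forall>x. (\<forall>y. B x y = 0) \<longrightarrow> x = 0)"

text \<open>Maps are written as functions, so \<open>g x\<close> stands for \<open>xg\<close>.\<close>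

definition Sp :: "(bit ^ 'm \<Rightarrow> bit ^ 'm \<Rightarrow> bit) \<Rightarrow> (bit ^ 'm \<Rightarrow> bit ^ 'm) set" where
  "Sp B = {g. Vector_Spaces.linear (*s) (*s) g \<and> bij g \<and> (\<forall>x y. B (g x) (g y) = B x y)}"

definition polar_form :: "(bit ^ 'm \<Rightarrow> bit) \<Rightarrow> bit ^ 'm \<Rightarrow> bit ^ 'm \<Rightarrow> bit" where
  "polar_form \<phi> x y = \<phi> (x + y) + \<phi> x + \<phi> y"

definition quadratic_form :: "(bit ^ 'm \<Rightarrow> bit) \<Rightarrow> bool" where
  "quadratic_form \<phi> \<longleftrightarrow>
     (\<forall>c x. \<phi> (c *s x) = c\<^sup>2 * \<phi> x) \<and> bilinear_form (polar_form \<phi>)"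

definition quad_forms :: "(bit ^ 'm \<Rightarrow> bit ^ 'm \<Rightarrow> bit) \<Rightarrow> (bit ^ 'm \<Rightarrow> bit) set" where
  "quad_forms B = {\<phi>. quadratic_form \<phi> \<and> (\<forall>x y. polar_form \<phi> x y = B x y)}"

definition totally_singular :: "(bit ^ 'm \<Rightarrow> bit) \<Rightarrow> (bit ^ 'm) set \<Rightarrow> bool" where
  "totally_singular \<phi> W \<longleftrightarrow> vec.subspace W \<and> (\<forall>w\<in>W. \<phi> w = 0)"

definition witt_index :: "(bit ^ 'm \<Rightarrow> bit) \<Rightarrow> nat" where
  "witt_index \<phi> = Max {vec.dim W | W. totally_singular \<phi> W}"

datatype form_type = Plus_type | Minus_type

text \<open>In dimension \<open>2n\<close>, a form has type \<open>+\<close> if its Witt index is \<open>n\<close>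
  and type \<open>-\<close> if its Witt index is \<open>n - 1\<close>.\<close>

fun has_type :: "(bit ^ 'm \<Rightarrow> bit) \<Rightarrow> form_type \<Rightarrow> bool" where
  "has_type (\<phi> :: bit ^ 'm \<Rightarrow> bit) Plus_type \<longleftrightarrow> 2 * witt_index \<phi> = CARD('m)"
| "has_type (\<phi> :: bit ^ 'm \<Rightarrow> bit) Minus_type \<longleftrightarrow> 2 * (witt_index \<phi> + 1) = CARD('m)"

definition quad_forms_of_type ::
    "(bit ^ 'm \<Rightarrow> bit ^ 'm \<Rightarrow> bit) \<Rightarrow> form_type \<Rightarrow> (bit ^ 'm \<Rightarrow> bit) set" where
  "quad_forms_of_type B \<epsilon> = {\<phi> \<in> quad_forms B. has_type \<phi> \<epsilon>}"

definition form_act :: "(bit ^ 'm \<Rightarrow> bit ^ 'm) \<Rightarrow> (bit ^ 'm \<Rightarrow> bit) \<Rightarrow> (bit ^ 'm \<Rightarrow> bit)" where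
  "form_act g \<phi> = (\<lambda>x. \<phi> (inv g x))"

definition form_stabiliser ::
    "(bit ^ 'm \<Rightarrow> bit ^ 'm) set \<Rightarrow> (bit ^ 'm \<Rightarrow> bit) \<Rightarrow> (bit ^ 'm \<Rightarrow> bit ^ 'm) set" where
  "form_stabiliser G \<psi> = {g \<in> G. form_act g \<psi> = \<psi>}"

definition setwise_stabiliser ::
    "(bit ^ 'm \<Rightarrow> bit ^ 'm) set \<Rightarrow> (bit ^ 'm \<Rightarrow> bit) set \<Rightarrow> (bit ^ 'm \<Rightarrow> bit ^ 'm) set" where
  "setwise_stabiliser G \<Delta> = {g \<in> G. form_act g ` \<Delta> = \<Delta>}"

definition irreducible_on_space :: "(bit ^ 'm \<Rightarrow> bit ^ 'm) set \<Rightarrow> bool" where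
  "irreducible_on_space G \<longleftrightarrow>
     (\<forall>W. vec.subspace W \<and> (\<forall>g\<in>G. g ` W \<subseteq> W) \<longrightarrow> W = {0} \<or> W = UNIV)"

definition transitive_via :: "('g \<Rightarrow> 'a \<Rightarrow> 'a) \<Rightarrow> 'g set \<Rightarrow> 'a set \<Rightarrow> bool" where
  "transitive_via act G S \<longleftrightarrow> (\<forall>x\<in>S. \<forall>y\<in>S. \<exists>g\<in>G. act g x = y)"

definition johnson_code :: "'a set \<Rightarrow> nat \<Rightarrow> 'a set set \<Rightarrow> bool" where
  "johnson_code \<Omega> k \<Gamma> \<longleftrightarrow> \<Gamma> \<noteq> {} \<and> (\<forall>\<Delta>\<in>\<Gamma>. \<Delta> \<subseteq> \<Omega> \<and> card \<Delta> = k)"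

definition strongly_incidence_transitive ::
    "(bit ^ 'm \<Rightarrow> bit ^ 'm) set \<Rightarrow> (bit ^ 'm \<Rightarrow> bit) set \<Rightarrow> (bit ^ 'm \<Rightarrow> bit) set set \<Rightarrow> bool" where
  "strongly_incidence_transitive G \<Omega> \<Gamma> \<longleftrightarrow>
     (\<forall>g\<in>G. (\<lambda>\<Delta>. form_act g ` \<Delta>) ` \<Gamma> = \<Gamma>) \<and>
     transitive_via (\<lambda>g \<Delta>. form_act g ` \<Delta>) G \<Gamma> \<and>
     (\<forall>\<Delta>\<in>\<Gamma>. transitive_via (\<lambda>g. map_prod (form_act g) (form_act g))
        (setwise_stabiliser G \<Delta>) (\<Delta> \<times> (\<Omega> - \<Delta>)))"

end

theory Submission
  imports Defs
begin

text \<open>Fix a form \<open>\<psi>\<close> stabilised by \<open>X\<^sub>\<Delta>\<close>. Every form in \<open>\<Q>\<close> is \<open>\<psi> + B(\<cdot>, a)\<close> for a unique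
  vector \<open>a\<close>, and the stabiliser of \<open>\<psi>\<close> acts on forms as it acts on these vectors. Let \<open>D\<close> and \<open>C\<close>
  be the sets of vectors belonging to \<open>\<Delta>\<close> and to its complement. Transitivity on
  \<open>\<Delta> \<times> (\<Q>\<^sup>\<epsilon> - \<Delta>)\<close> makes \<open>B\<close> constant on \<open>D \<times> C\<close>, so \<open>C\<close> lies in the
  invariant subspace orthogonal to all differences of elements of \<open>D\<close>. As \<open>C\<close> contains a nonzero
  vector, irreducibility makes this subspace all of \<open>V\<close>, whence \<open>D\<close> has only one element.\<close>

lemma bit_add_eq_0_iff: "x + y = 0 \<longleftrightarrow> x = y" for x y :: bit
  by (cases x; cases y) simp_all

lemma bilinear_form_simps:
  assumes "bilinear_form B"
  shows "B x (y + z) = B x y + B x z" "B (y + z) x = B y x + B z x"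
    "B x (c *s y) = c * B x y" "B (c *s y) x = c * B y x"
    "B x 0 = 0" "B 0 x = 0"
proof -
  have r: "Vector_Spaces.linear (*s) (*) (B x)"
    and l: "Vector_Spaces.linear (*s) (*) (\<lambda>y. B y x)"
    using assms by (auto simp: bilinear_form_def)
  interpret r: Vector_Spaces.linear "(*s)" "(*)" "B x" by (rule r)
  interpret l: Vector_Spaces.linear "(*s)" "(*)" "\<lambda>y. B y x" by (rule l)
  show "B x (y + z) = B x y + B x z" "B (y + z) x = B y x + B z x"
    "B x (c *s y) = c * B x y" "B (c *s y) x = c * B y x" "B x 0 = 0" "B 0 x = 0"
    by (rule r.add l.add r.scale l.scale r.zero l.zero)+
qed

text \<open>The alternating law at \<open>x + y\<close> leaves only the two cross terms, so these
  are equal in characteristic 2.\<close>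

lemma symplectic_form_sym:
  assumes "symplectic_form B"
  shows "B x y = B y x"
proof -
  have b: "bilinear_form B" and a: "\<And>z. B z z = 0"
    using assms by (auto simp: symplectic_form_def)
  have "B (x + y) (x + y) = (B x x + B x y) + (B y x + B y y)"
    by (simp only: bilinear_form_simps[OF b] ac_simps)
  then have "B x y + B y x = 0"
    by (simp only: a add_0_left add_0_right)
  then show ?thesis by (simp only: bit_add_eq_0_iff)
qed

text \<open>\<open>T y\<close> lists the values of \<open>B _ y\<close> on the standard basis.
  Nondegeneracy makes \<open>T\<close> injective, hence surjective by finite dimension, and a
  preimage of the values of \<open>f\<close> on that basis is the required vector.\<close>

lemma symplectic_form_represents:
  fixes B :: "bit ^ 'm \<Rightarrow> bit ^ 'm \<Rightarrow> bit" and f :: "bit ^ 'm \<Rightarrow> bit"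
  assumes "symplectic_form B" and "Vector_Spaces.linear (*s) (*) f"
  obtains a where "\<And>x. f x = B x a"
proof -
  have b: "bilinear_form B" and nd: "\<And>x. (\<And>y. B x y = 0) \<Longrightarrow> x = 0"
    using assms by (auto simp: symplectic_form_def)
  define T :: "bit ^ 'm \<Rightarrow> bit ^ 'm" where "T y = (\<chi> i. B (axis i 1) y)" for y
  have coord: "h x = (\<Sum>i\<in>UNIV. x $ i * h (axis i 1))"
    if "Vector_Spaces.linear (*s) (*) h" for h :: "bit ^ 'm \<Rightarrow> bit" and x
  proof -
    interpret h: Vector_Spaces.linear "(*s)" "(*)" h by (rule that)
    have "h x = h (\<Sum>i\<in>UNIV. x $ i *s axis i 1)" by (simp add: basis_expansion)
    then show ?thesis by (simp add: h.sum h.scale)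
  qed
  have B_coord: "B x y = (\<Sum>i\<in>UNIV. x $ i * T y $ i)" for x y
    using coord[of "\<lambda>x. B x y" x] b by (simp add: bilinear_form_def T_def)
  have lin: "Vector_Spaces.linear (*s) (*s) T"
    by unfold_locales (auto simp: T_def vec_eq_iff bilinear_form_simps[OF b])
  have "inj T"
  proof -
    interpret T: Vector_Spaces.linear "(*s)" "(*s)" T by (rule lin)
    have "y = 0" if "T y = 0" for y
    \<comment> \<open>\<open>T y = 0\<close> kills \<open>B\<close> with \<open>y\<close> on the
      right, while nondegeneracy is stated for the left argument; symmetry bridges the two.\<close>
    proof (rule nd)
      have "B x y = 0" for x by (simp only: B_coord that) simp
      then show "B y x = 0" for x by (simp only: symplectic_form_sym[OF assms(1), of y x])
    qed
    then show ?thesis by (simp add: T.inj_iff_eq_0)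
  qed
  then have "surj T" using vec.linear_injective_imp_surjective lin by blast
  then obtain a where a: "T a = (\<chi> i. f (axis i 1))" by (metis surj_def)
  have "f x = B x a" for x
    by (simp add: B_coord a coord[OF assms(2), of x])
  then show thesis by (rule that)
qed

text \<open>In the sum of the two forms the equal polar forms cancel, leaving an additive map; it is
  homogeneous because \<open>c\<^sup>2 = c\<close> for bits. This linear functional is then
  represented by a vector.\<close>

lemma quad_forms_translate:
  fixes B :: "bit ^ 'm \<Rightarrow> bit ^ 'm \<Rightarrow> bit"
  assumes "symplectic_form B" and "\<phi> \<in> quad_forms B" and "\<psi> \<in> quad_forms B"
  obtains a where "\<And>x. \<phi> x = \<psi> x + B x a"
proof -
  have p: "\<phi> (x + y) + \<phi> x + \<phi> y = B x y" "\<psi> (x + y) + \<psi> x + \<psi> y = B x y" for x y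
    using assms(2,3) by (auto simp: quad_forms_def polar_form_def)
  have s: "\<phi> (c *s x) = c\<^sup>2 * \<phi> x" "\<psi> (c *s x) = c\<^sup>2 * \<psi> x" for c x
    using assms(2,3) by (auto simp: quad_forms_def quadratic_form_def)
  have "\<phi> (x + y) + \<psi> (x + y) = \<phi> x + \<psi> x + (\<phi> y + \<psi> y)" for x y
    using p[of x y]
    by (cases "\<phi> (x + y)"; cases "\<psi> (x + y)"; cases "\<phi> x"; cases "\<psi> x"; cases "\<phi> y"; cases "\<psi> y") auto
  moreover have "\<phi> (c *s x) + \<psi> (c *s x) = c * (\<phi> x + \<psi> x)" for c x
    using s[of c x] by (cases c) auto
  ultimately have "Vector_Spaces.linear (*s) (*) (\<lambda>x. \<phi> x + \<psi> x)"
    by unfold_locales (auto simp: algebra_simps)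
  then obtain a where a: "\<And>x. \<phi> x + \<psi> x = B x a"
    using symplectic_form_represents[OF assms(1)] by blast
  have "\<phi> x = \<psi> x + B x a" for x
    using a[of x] by (cases "\<phi> x"; cases "\<psi> x") auto
  then show thesis by (rule that)
qed

lemma symplectic_form_right_cancel:
  assumes "symplectic_form B" and "\<And>x. B x a = B x b"
  shows "a = b"
proof -
  have b: "bilinear_form B" and nd: "\<And>x. (\<And>y. B x y = 0) \<Longrightarrow> x = 0"
    using assms(1) by (auto simp: symplectic_form_def)
  have "a + b = 0"
  proof (rule nd)
    show "B (a + b) y = 0" for y
      using assms(2)[of y] symplectic_form_sym[OF assms(1), of y a]
        symplectic_form_sym[OF assms(1), of y b]
      by (simp only: bilinear_form_simps[OF b] bit_add_eq_0_iff)
  qed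
  then show ?thesis unfolding vec_eq_iff vector_add_component zero_index bit_add_eq_0_iff .
qed

text \<open>As \<open>g\<close> fixes \<open>\<psi>\<close>, only the linear part moves, and the
  isometry shifts \<open>inv g\<close> from one argument of \<open>B\<close> to \<open>g\<close> on
  the other.\<close>

lemma form_act_translate:
  assumes "symplectic_form B" and "g \<in> form_stabiliser (Sp B) \<psi>"
    and "\<And>x. \<phi> x = \<psi> x + B x a"
  shows "form_act g \<phi> x = \<psi> x + B x (g a)"
proof -
  have g: "bij g" "\<And>x y. B (g x) (g y) = B x y" and fx: "form_act g \<psi> = \<psi>"
    using assms(2) by (auto simp: form_stabiliser_def Sp_def)
  have "\<psi> (inv g x) = \<psi> x" using fx by (metis form_act_def)
  moreover have "B (inv g x) a = B x (g a)"
    using g(2)[of "inv g x" a] g(1) by (simp add: bij_is_surj surj_f_inv_f)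
  ultimately show ?thesis by (simp add: form_act_def assms(3))
qed

theorem theorem6p14:
  fixes B :: "bit ^ 'm \<Rightarrow> bit ^ 'm \<Rightarrow> bit"
    and n k :: nat
    and \<epsilon> :: form_type
    and \<Gamma> :: "(bit ^ 'm \<Rightarrow> bit) set set"
    and \<Delta> :: "(bit ^ 'm \<Rightarrow> bit) set"
  assumes "CARD('m) = 2 * n" and "n \<ge> 2"
    and "symplectic_form B"
    and "2 \<le> k" and "k + 2 \<le> card (quad_forms_of_type B \<epsilon>)"
    and "johnson_code (quad_forms_of_type B \<epsilon>) k \<Gamma>"
    and "strongly_incidence_transitive (Sp B) (quad_forms_of_type B \<epsilon>) \<Gamma>"
    and "\<Delta> \<in> \<Gamma>"
    and "irreducible_on_space (setwise_stabiliser (Sp B) \<Delta>)"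
  shows "\<forall>\<psi> \<in> quad_forms B.
    \<not> setwise_stabiliser (Sp B) \<Delta> \<subseteq> form_stabiliser (Sp B) \<psi>"
proof (intro ballI notI)
  fix \<psi> assume \<psi>: "\<psi> \<in> quad_forms B"
    and sub: "setwise_stabiliser (Sp B) \<Delta> \<subseteq> form_stabiliser (Sp B) \<psi>"
  let ?\<Omega> = "quad_forms_of_type B \<epsilon>" and ?G = "setwise_stabiliser (Sp B) \<Delta>"
  note sf = assms(3)
  have b: "bilinear_form B" using sf by (simp add: symplectic_form_def)
  note bs = bilinear_form_simps[OF b]
  have \<Delta>: "\<Delta> \<subseteq> ?\<Omega>" "card \<Delta> = k"
    using assms(6,8) by (auto simp: johnson_code_def)
  have \<Omega>: "?\<Omega> \<subseteq> quad_forms B" by (auto simp: quad_forms_of_type_def)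
  \<comment> \<open>An infinite set has \<open>card\<close> 0, which \<open>2 \<le> k\<close>
    excludes.\<close>
  have "finite \<Delta>" using \<Delta>(2) assms(4) by (metis card.infinite not_numeral_le_zero)
  then have card_compl: "card (?\<Omega> - \<Delta>) \<ge> 2"
    using \<Delta> assms(5) by (simp add: card_Diff_subset)
  have "\<forall>\<phi>\<in>quad_forms B. \<exists>a. \<forall>x. \<phi> x = \<psi> x + B x a"
    using quad_forms_translate[OF sf _ \<psi>] by metis
  then obtain v where v: "\<And>\<phi> x. \<phi> \<in> quad_forms B \<Longrightarrow> \<phi> x = \<psi> x + B x (v \<phi>)"
    by metis
  have v_inj: "\<phi> = \<theta>" if "\<phi> \<in> quad_forms B" "\<theta> \<in> quad_forms B" "v \<phi> = v \<theta>" for \<phi> \<theta>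
    using v[OF that(1)] v[OF that(2)] that(3) by (intro ext) simp
  \<comment> \<open>Nothing is known of \<open>v\<close> outside \<open>quad_forms B\<close>, hence
    the membership condition on the image as well.\<close>
  have v_act: "v (form_act g \<phi>) = g (v \<phi>)"
    if "g \<in> ?G" "\<phi> \<in> quad_forms B" "form_act g \<phi> \<in> quad_forms B" for g \<phi>
  proof (rule symplectic_form_right_cancel[OF sf])
    fix x
    have "g \<in> form_stabiliser (Sp B) \<psi>" using sub that(1) by blast
    from form_act_translate[OF sf this v[OF that(2)], of x] v[OF that(3), of x]
    show "B x (v (form_act g \<phi>)) = B x (g (v \<phi>))" by (metis add_left_imp_eq)
  qed
  have const: "B (v \<theta>) (v \<phi>) = B (v \<theta>) (v \<phi>')"
    if "\<phi> \<in> \<Delta>" "\<phi>' \<in> \<Delta>" "\<theta> \<in> ?\<Omega> - \<Delta>" for \<phi> \<phi>' \<theta>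
  proof -
    have "transitive_via (\<lambda>g. map_prod (form_act g) (form_act g)) ?G (\<Delta> \<times> (?\<Omega> - \<Delta>))"
      using assms(7,8) by (simp add: strongly_incidence_transitive_def)
    \<comment> \<open>The element \<open>g\<close> is chosen to fix \<open>\<theta>\<close> while
      moving \<open>\<phi>\<close> to \<open>\<phi>'\<close>; being an isometry, it carries one
      value of \<open>B\<close> to the other.\<close>
    then have "\<exists>g\<in>?G. map_prod (form_act g) (form_act g) (\<phi>, \<theta>) = (\<phi>', \<theta>)"
      using that unfolding transitive_via_def by blast
    then obtain g where g: "g \<in> ?G" "form_act g \<phi> = \<phi>'" "form_act g \<theta> = \<theta>" by auto
    have mem: "\<phi> \<in> quad_forms B" "\<phi>' \<in> quad_forms B" "\<theta> \<in> quad_forms B"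
      using that \<Delta>(1) \<Omega> by auto
    have "v \<phi>' = g (v \<phi>)" "v \<theta> = g (v \<theta>)"
      using v_act[OF g(1)] g mem by metis+
    moreover have "B (g (v \<theta>)) (g (v \<phi>)) = B (v \<theta>) (v \<phi>)"
      using g(1) by (simp add: setwise_stabiliser_def Sp_def)
    ultimately show ?thesis by simp
  qed
  define U where "U = {x. \<forall>\<phi>\<in>\<Delta>. \<forall>\<phi>'\<in>\<Delta>. B x (v \<phi>) = B x (v \<phi>')}"
  have "vec.subspace U"
  proof (rule vec.subspaceI)
    show "0 \<in> U" by (simp add: U_def bs)
    show "x + y \<in> U" if "x \<in> U" "y \<in> U" for x y
      using that unfolding U_def bs mem_Collect_eq by (metis (no_types, lifting))
    show "c *s x \<in> U" if "x \<in> U" for c x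
      using that unfolding U_def bs mem_Collect_eq by (metis (no_types, lifting))
  qed
  moreover have "g ` U \<subseteq> U" if g: "g \<in> ?G" for g
  proof -
    have "B (g x) (v \<phi>) = B (g x) (v \<phi>')" if x: "x \<in> U" and "\<phi> \<in> \<Delta>" "\<phi>' \<in> \<Delta>" for x \<phi> \<phi>'
    proof -
      \<comment> \<open>Pulling \<open>\<phi>\<close> and \<open>\<phi>'\<close> back along
        \<open>g\<close> inside \<open>\<Delta>\<close> turns the condition on \<open>g x\<close>
        into one that \<open>x\<close> satisfies.\<close>
      have "form_act g ` \<Delta> = \<Delta>" using g by (simp add: setwise_stabiliser_def)
      then have "\<phi> \<in> form_act g ` \<Delta>" "\<phi>' \<in> form_act g ` \<Delta>"
        using that by auto
      then obtain \<alpha> \<beta> where *: "\<alpha> \<in> \<Delta>" "\<phi> = form_act g \<alpha>" "\<beta> \<in> \<Delta>" "\<phi>' = form_act g \<beta>"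
        by blast
      have vg: "v \<phi> = g (v \<alpha>)" "v \<phi>' = g (v \<beta>)"
        unfolding * by (rule v_act[OF g]; use * that \<Delta>(1) \<Omega> in blast)+
      have "B (g x) (g y) = B x y" for y
        using g by (simp add: setwise_stabiliser_def Sp_def)
      moreover have "B x (v \<alpha>) = B x (v \<beta>)"
        using x *(1,3) unfolding U_def by blast
      ultimately show ?thesis by (simp only: vg)
    qed
    then show ?thesis unfolding U_def by blast
  qed
  ultimately have U: "U = {0} \<or> U = UNIV"
    by (intro assms(9)[unfolded irreducible_on_space_def, rule_format] conjI ballI)
  \<comment> \<open>A single form would not suffice: \<open>v \<theta> = 0\<close> when
    \<open>\<theta> = \<psi>\<close>. Two distinct vectors in \<open>U\<close> rule out
    \<open>U = {0}\<close>.\<close>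
  obtain \<theta> \<theta>' where \<theta>: "\<theta> \<in> ?\<Omega> - \<Delta>" "\<theta>' \<in> ?\<Omega> - \<Delta>" "\<theta> \<noteq> \<theta>'"
    using ex_card[OF card_compl] by (auto simp: card_2_iff)
  have "v \<theta> \<in> U" "v \<theta>' \<in> U" using const \<theta> unfolding U_def by blast+
  moreover have "v \<theta> \<noteq> v \<theta>'" using v_inj \<theta> \<Omega> by blast
  ultimately have "U = UNIV" using U by (metis singletonD)
  then have all: "B x (v \<phi>) = B x (v \<phi>')" if "\<phi> \<in> \<Delta>" "\<phi>' \<in> \<Delta>" for x \<phi> \<phi>'
    using that unfolding U_def by blast
  obtain \<phi> \<phi>' where \<phi>: "\<phi> \<in> \<Delta>" "\<phi>' \<in> \<Delta>" "\<phi> \<noteq> \<phi>'"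
    using ex_card[of 2 \<Delta>] \<Delta>(2) assms(4) by (auto simp: card_2_iff)
  have "v \<phi> = v \<phi>'"
    by (rule symplectic_form_right_cancel[OF sf all[OF \<phi>(1,2)]])
  then show False using v_inj \<phi> \<Delta>(1) \<Omega> by blast
qed

end
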